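(* Let $p$ be a prime (including $p=2$) and $n>2$. A minimal involutive generating set of $ESL_n(\mathbb{F}_p)$ contains at least $3$ generators. The exceptional case $ESL_2(\mathbb{F}_2)$ is a 2-generated group; moreover $ESL_2(\mathbb{F}_2)\simeq D_3\simeq\langle\rho,t_{12}\rangle$, where $$\rho=\begin{pmatrix}0&1\\1&0\end{pmatrix},\qquad t_{12}=\begin{pmatrix}1&1\\0&1\end{pmatrix}$$ over $\mathbb{F}_2$.
   Context: $ESL_n(\mathbb{F}_p)$ denotes the group of all $n\times n$ matrices over $\mathbb{F}_p$ with determinant $1$ or $-1$. An involutive generating set of a group is a generating set all of whose elements are involutions (elements of order $2$); it is minimal if no involutive generating set of smaller cardinality exists. $D_3$ is the dihedral group of order $6$. *)

theory Defs
  imports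
    "HOL-Algebra.Multiplicative_Group"
    "HOL-Algebra.Generated_Groups"
    "HOL-Library.Equipollence"
    "Jordan_Normal_Form.Determinant"
    "Berlekamp_Zassenhaus.Finite_Field"
begin

text \<open>
  The field with \<open>p\<close> elements is \<open>'p mod_ring\<close>, the integers modulo \<open>CARD('p)\<close>, for a type
  \<open>'p\<close> whose cardinality is the prime \<open>p\<close>.
\<close>

definition ESL :: "nat \<Rightarrow> 'a::comm_ring_1 mat monoid" where
  "ESL n = \<lparr>carrier = {A \<in> carrier_mat n n. det A = 1 \<or> det A = - 1},
            monoid.mult = (*), one = 1\<^sub>m n\<rparr>"

definition involution :: "('a, 'b) monoid_scheme \<Rightarrow> 'a \<Rightarrow> bool" where
  "involution G x \<longleftrightarrow> x \<in> carrier G \<and> group.ord G x = 2"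

definition generating_set :: "('a, 'b) monoid_scheme \<Rightarrow> 'a set \<Rightarrow> bool" where
  "generating_set G S \<longleftrightarrow> S \<subseteq> carrier G \<and> generate G S = carrier G"

definition involutive_generating_set :: "('a, 'b) monoid_scheme \<Rightarrow> 'a set \<Rightarrow> bool" where
  "involutive_generating_set G S \<longleftrightarrow> generating_set G S \<and> (\<forall>x\<in>S. involution G x)"

text \<open>
  Minimality refers to cardinality, not to inclusion.  Cardinalities are compared with
  \<open>\<prec>\<close> because \<open>card\<close> does not see infinite sets.
\<close>

definition minimal_involutive_generating_set :: "('a, 'b) monoid_scheme \<Rightarrow> 'a set \<Rightarrow> bool" where
  "minimal_involutive_generating_set G S \<longleftrightarrow>
     involutive_generating_set G S \<and> \<not> (\<exists>T. involutive_generating_set G T \<and> T \<prec> S)"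

text \<open>
  The dihedral group of order \<open>2 * n\<close>, for \<open>n > 0\<close>.  With \<open>r\<close> the rotation and \<open>s\<close> a reflection,
  the pair \<open>(k, a)\<close> stands for \<open>r\<^sup>k\<close> if \<open>a\<close> is false and for \<open>r\<^sup>k s\<close> if \<open>a\<close> is true; the
  product is the one forced by \<open>s r = r\<^sup>-\<^sup>1 s\<close>.
\<close>

definition dihedral_group :: "nat \<Rightarrow> (int \<times> bool) monoid" where
  "dihedral_group n =
     \<lparr>carrier = {0..<int n} \<times> UNIV,
      monoid.mult = (\<lambda>(k, a) (l, b). ((if a then k - l else k + l) mod int n, a \<noteq> b)),
      one = (0, False)\<rparr>"

definition rho_mat :: "'a::comm_ring_1 mat" where
  "rho_mat = mat_of_rows_list 2 [[0, 1], [1, 0]]"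

definition t12_mat :: "'a::comm_ring_1 mat" where
  "t12_mat = mat_of_rows_list 2 [[1, 1], [0, 1]]"

end

theory Submission
  imports Defs
begin

text \<open>
  A group generated by two involutions \<open>a\<close> and \<open>b\<close> is dihedral: with the rotation
  \<open>r = a \<otimes> b\<close>, every element is a rotation \<open>r\<^sup>k\<close> or a reflection \<open>r\<^sup>k \<otimes> a\<close>, because \<open>a\<close>
  inverts \<open>r\<close> (\<open>generate_two_involutions\<close>).  Reflections square to the identity, so all squares are
  powers of \<open>r\<close>, and any two squares commute
  (\<open>squares_commute_if_generated_by_two_involutions\<close>).  This law refutes two generators as soon as
  a group contains two elements whose squares do not commute.

  For \<open>n > 2\<close> the group \<open>ESL n\<close> contains such a pair in every characteristic: the unipotent upper
  triangular Jordan block of size 3 and its transpose, extended by an identity block.  The two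
  products of their squares differ by 5 in one entry and by 2 in another, and 5 and 2 cannot both
  vanish in a ring with \<open>0 \<noteq> 1\<close> (\<open>unipotent3_squares_not_commute\<close>).  Because of this no case
  distinction between \<open>p = 2\<close> and odd \<open>p\<close> is needed, although transvections, the obvious candidates,
  square to the identity when \<open>p = 2\<close>.

  Over the field with two elements, \<open>\<rho> t\<^sub>1\<^sub>2\<close> has order 3 and is inverted by \<open>\<rho>\<close>, which gives a
  homomorphism from the dihedral group of order 6.  Its six values are exactly the six invertible
  matrices of size 2 (\<open>iso_dihedral_3_ESL_2\<close>); all of them are products of \<open>\<rho>\<close> and \<open>t\<^sub>1\<^sub>2\<close>, so these
  two involutions generate.  One involution cannot, as the group is not commutative.
\<close>

section \<open>Groups generated by two involutions\<close>

text \<open>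
  Conjugation by the involution \<open>s\<close> is an endomorphism, so it commutes with integer powers and
  inverts every power of \<open>r\<close> once it inverts \<open>r\<close>.
\<close>

lemma (in group) reflect_int_pow:
  assumes "r \<in> carrier G" "s \<in> carrier G" "s \<otimes> s = \<one>" "s \<otimes> r \<otimes> s = inv r"
  shows "s \<otimes> r [^] (k::int) = r [^] (- k) \<otimes> s"
proof -
  have "(\<lambda>x. s \<otimes> x \<otimes> s) \<in> hom G G"
  proof (rule homI)
    fix x y assume "x \<in> carrier G" "y \<in> carrier G"
    moreover from this have "s \<otimes> x \<otimes> s \<otimes> (s \<otimes> y \<otimes> s) = s \<otimes> x \<otimes> (s \<otimes> s) \<otimes> y \<otimes> s"
      using assms(2) by (simp add: m_assoc)
    ultimately show "s \<otimes> (x \<otimes> y) \<otimes> s = s \<otimes> x \<otimes> s \<otimes> (s \<otimes> y \<otimes> s)"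
      using assms(2,3) by (simp add: m_assoc)
  qed (use assms in auto)
  then have "s \<otimes> r [^] k \<otimes> s = (s \<otimes> r \<otimes> s) [^] k"
    using hom_int_pow[of "\<lambda>x. s \<otimes> x \<otimes> s" G G r k] assms(1) is_group by simp
  also have "\<dots> = r [^] (- k)"
    using assms by (simp add: int_pow_inv int_pow_neg)
  finally have "s \<otimes> r [^] k \<otimes> (s \<otimes> s) = r [^] (- k) \<otimes> s"
    using assms(1,2) by (simp flip: m_assoc)
  then show ?thesis
    using assms by simp
qed

text \<open>
  The part of the dihedral multiplication table in which a reflection stands on the left; it is
  what makes the set of all \<open>r\<^sup>k\<close> and \<open>r\<^sup>k \<otimes> s\<close> closed under products.
\<close>

lemma (in group) reflection_mult:
  assumes "r \<in> carrier G" "s \<in> carrier G" "s \<otimes> s = \<one>" "s \<otimes> r \<otimes> s = inv r"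
  shows "r [^] k \<otimes> s \<otimes> r [^] l = r [^] (k - l :: int) \<otimes> s"
    and "r [^] k \<otimes> s \<otimes> (r [^] l \<otimes> s) = r [^] (k - l)"
proof -
  show refl: "r [^] k \<otimes> s \<otimes> r [^] l = r [^] (k - l) \<otimes> s"
  proof -
    have "r [^] k \<otimes> s \<otimes> r [^] l = r [^] k \<otimes> r [^] (- l) \<otimes> s"
      using assms(1,2) reflect_int_pow[OF assms] by (simp add: m_assoc)
    then show ?thesis
      using assms(1) by (simp flip: int_pow_mult)
  qed
  have "r [^] k \<otimes> s \<otimes> (r [^] l \<otimes> s) = r [^] (k - l) \<otimes> s \<otimes> s"
    using assms(1,2) by (simp flip: m_assoc refl)
  then show "r [^] k \<otimes> s \<otimes> (r [^] l \<otimes> s) = r [^] (k - l)"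
    using assms(1-3) by (simp add: m_assoc)
qed

lemma (in group) involution_inverts_product:
  assumes "a \<in> carrier G" "b \<in> carrier G" "a \<otimes> a = \<one>" "b \<otimes> b = \<one>"
  shows "inv (a \<otimes> b) = b \<otimes> a" and "a \<otimes> (a \<otimes> b) \<otimes> a = inv (a \<otimes> b)"
proof -
  have "inv a = a" "inv b = b"
    using assms by (auto intro: inv_equality)
  then show inv: "inv (a \<otimes> b) = b \<otimes> a"
    using assms by (simp add: inv_mult_group)
  have "a \<otimes> (a \<otimes> b) \<otimes> a = a \<otimes> a \<otimes> (b \<otimes> a)"
    using assms(1,2) by (simp add: m_assoc)
  then show "a \<otimes> (a \<otimes> b) \<otimes> a = inv (a \<otimes> b)"
    using assms by (simp add: inv)
qed

lemma (in group) generate_two_involutions: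
  assumes "a \<in> carrier G" "b \<in> carrier G" "a \<otimes> a = \<one>" "b \<otimes> b = \<one>"
    and "x \<in> generate G {a, b}"
  shows "\<exists>k::int. x = (a \<otimes> b) [^] k \<or> x = (a \<otimes> b) [^] k \<otimes> a"
proof -
  define r where "r = a \<otimes> b"
  have r: "r \<in> carrier G" using assms by (simp add: r_def)
  note inverts = involution_inverts_product[OF assms(1-4), folded r_def]
  note mult = reflection_mult[OF r assms(1,3) inverts(2)]
  have mult': "r [^] k \<otimes> (r [^] l \<otimes> a) = r [^] (k + l) \<otimes> a" for k l :: int
    using r assms(1) by (simp add: int_pow_mult m_assoc)
  (* The generators are reflections themselves, with exponents 0 and -1. *)
  have a_form: "a = r [^] (0::int) \<otimes> a" using assms(1) by simp
  have "b = inv r \<otimes> a"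
    using assms by (simp add: inverts(1) m_assoc)
  then have b_form: "b = r [^] (- 1::int) \<otimes> a"
    using r by (simp add: int_pow_neg)
  have inv_ab: "inv a = a" "inv b = b"
    using assms by (auto intro: inv_equality)
  have "\<exists>k::int. x = r [^] k \<or> x = r [^] k \<otimes> a"
    using assms(5)
  proof (induction rule: generate.induct)
    case one
    have "\<one> = r [^] (0::int)" by simp
    then show ?case by blast
  next
    case (incl h)
    then show ?case using a_form b_form by blast
  next
    case (inv h)
    then have "inv h = a \<or> inv h = b" using inv_ab by auto
    then show ?case using a_form b_form by metis
  next
    case (eng g h)
    then show ?case
      using mult mult' int_pow_mult[OF r] by metis
  qed
  then show ?thesis by (simp add: r_def)
qed

text \<open>
  All squares lie in the cyclic group of the rotations.
\<close>

lemma (in group) squares_commute_if_generated_by_two_involutions: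
  assumes "a \<in> carrier G" "b \<in> carrier G" "a \<otimes> a = \<one>" "b \<otimes> b = \<one>"
    and "x \<in> generate G {a, b}" "y \<in> generate G {a, b}"
  shows "(x \<otimes> x) \<otimes> (y \<otimes> y) = (y \<otimes> y) \<otimes> (x \<otimes> x)"
proof -
  define r where "r = a \<otimes> b"
  have r: "r \<in> carrier G" using assms by (simp add: r_def)
  note inverts = involution_inverts_product[OF assms(1-4), folded r_def]
  note mult = reflection_mult[OF r assms(1,3) inverts(2)]
  have square: "\<exists>k::int. z \<otimes> z = r [^] k" if "z \<in> generate G {a, b}" for z
    using generate_two_involutions[OF assms(1-4) that, folded r_def]
      mult(2) int_pow_mult[OF r] by metis
  from square[OF assms(5)] square[OF assms(6)] show ?thesis
    using int_pow_mult[OF r] by (metis add.commute)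
qed

lemma (in group) involution_iff:
  "involution G x \<longleftrightarrow> x \<in> carrier G \<and> x \<otimes> x = \<one> \<and> x \<noteq> \<one>"
proof (cases "x \<in> carrier G")
  case True
  have "ord x = 2 \<longleftrightarrow> ord x dvd 2 \<and> ord x \<noteq> 1"
    using prime_nat_iff two_is_prime_nat by auto
  also have "\<dots> \<longleftrightarrow> x [^] (2::nat) = \<one> \<and> x \<noteq> \<one>"
    using True ord_eq_1 by (simp add: pow_eq_id)
  finally show ?thesis
    using True by (simp add: involution_def numeral_2_eq_2)
qed (simp add: involution_def)

text \<open>
  Padding with the identity lets the two-generator law cover the sets of fewer than two elements:
  the law asks only that the generators square to the identity.
\<close>

lemma (in group) involutive_generating_set_card_le_2_squares_commute:
  assumes S: "involutive_generating_set G S" and "finite S" "card S \<le> 2"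
    and "x \<in> carrier G" "y \<in> carrier G"
  shows "(x \<otimes> x) \<otimes> (y \<otimes> y) = (y \<otimes> y) \<otimes> (x \<otimes> x)"
proof -
  have S_props: "S \<subseteq> carrier G" "generate G S = carrier G" "\<And>s. s \<in> S \<Longrightarrow> s \<otimes> s = \<one>"
    using S involution_iff
    by (auto simp: involutive_generating_set_def generating_set_def)
  have "card S = 0 \<or> card S = 1 \<or> card S = 2" using assms(3) by linarith
  then have "S = {} \<or> (\<exists>a. S = {a}) \<or> (\<exists>a b. S = {a, b})"
    using \<open>finite S\<close> by (auto simp: card_1_singleton_iff card_2_iff)
  then have "S = {} \<or> (\<exists>a b. S = {a, b})"
    by (metis insert_absorb2)
  then obtain a b where ab: "a \<in> carrier G" "b \<in> carrier G" "a \<otimes> a = \<one>" "b \<otimes> b = \<one>"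
    "S \<subseteq> {a, b}"
    using S_props that[of \<one> \<one>] by auto
  have "carrier G \<subseteq> generate G {a, b}"
    using mono_generate[OF ab(5)] S_props by simp
  then show ?thesis
    using squares_commute_if_generated_by_two_involutions[OF ab(1-4)] assms(4,5) by blast
qed

lemma (in group) involutive_generating_set_card_le_1_comm:
  assumes S: "involutive_generating_set G S" and "finite S" "card S \<le> 1"
    and "x \<in> carrier G" "y \<in> carrier G"
  shows "x \<otimes> y = y \<otimes> x"
proof -
  have S_props: "S \<subseteq> carrier G" "generate G S = carrier G"
    using S by (auto simp: involutive_generating_set_def generating_set_def)
  have "card S = 0 \<or> card S = 1" using assms(3) by linarith
  then have "S = {} \<or> (\<exists>a. S = {a})"
    using \<open>finite S\<close> by (auto simp: card_1_singleton_iff)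
  then obtain a where a: "a \<in> carrier G" "S \<subseteq> {a}"
    using S_props by auto
  have "carrier G \<subseteq> generate G {a}"
    using mono_generate[OF a(2)] S_props by simp
  then obtain k l :: int where "x = a [^] k" "y = a [^] l"
    using assms(4,5) generate_pow[OF a(1)] by blast
  then show ?thesis
    using int_pow_mult[OF a(1)] by (metis add.commute)
qed

section \<open>Homomorphisms out of the dihedral group\<close>

lemma group_dihedral_group:
  assumes "n > 0"
  shows "group (dihedral_group n)"
proof (rule groupI)
  show "\<exists>y\<in>carrier (dihedral_group n). y \<otimes>\<^bsub>dihedral_group n\<^esub> x = \<one>\<^bsub>dihedral_group n\<^esub>"
    if "x \<in> carrier (dihedral_group n)" for x
  proof (cases x)
    case (Pair k a)
    then have "(if a then k else (- k) mod int n, a) \<in> carrier (dihedral_group n)"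
      using that assms by (auto simp: dihedral_group_def)
    moreover have "(if a then k else (- k) mod int n, a) \<otimes>\<^bsub>dihedral_group n\<^esub> x
        = \<one>\<^bsub>dihedral_group n\<^esub>"
      by (simp add: Pair dihedral_group_def mod_simps)
    ultimately show ?thesis by blast
  qed
qed (use assms in \<open>auto simp: dihedral_group_def mod_simps algebra_simps\<close>)

text \<open>
  The universal property of the presentation
  \<open>\<langle>r, s | r\<^sup>n = s\<^sup>2 = 1, s r s = r\<^sup>-\<^sup>1\<rangle>\<close>.
\<close>

lemma (in group) hom_dihedral_group:
  assumes "r \<in> carrier G" "s \<in> carrier G" "r [^] n = \<one>" "s \<otimes> s = \<one>" "s \<otimes> r \<otimes> s = inv r"
  shows "(\<lambda>(k, a). r [^] k \<otimes> (if a then s else \<one>)) \<in> hom (dihedral_group n) G"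
proof (rule homI)
  (* Rotations are multiplied modulo n in the dihedral group; powers of r do not see this. *)
  have mod: "r [^] (k mod int n) = r [^] k" for k
  proof -
    have "r [^] k = (r [^] int n) [^] (k div int n) \<otimes> r [^] (k mod int n)"
      using assms(1) by (simp add: int_pow_pow flip: int_pow_mult)
    then show ?thesis
      using assms(1,3) by (simp add: int_pow_int)
  qed
  note mult = reflection_mult[OF assms(1,2,4,5)]
  have mult': "r [^] (k::int) \<otimes> (r [^] l \<otimes> s) = r [^] (k + l) \<otimes> s" for k l
    using assms(1,2) by (simp add: int_pow_mult m_assoc)
  fix x y :: "int \<times> bool"
  obtain k a l b where "x = (k, a)" "y = (l, b)" by force
  then show "(\<lambda>(k, a). r [^] k \<otimes> (if a then s else \<one>)) (x \<otimes>\<^bsub>dihedral_group n\<^esub> y)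
      = (\<lambda>(k, a). r [^] k \<otimes> (if a then s else \<one>)) x \<otimes>
        (\<lambda>(k, a). r [^] k \<otimes> (if a then s else \<one>)) y"
    using assms(1,2)
    by (auto simp: dihedral_group_def mod mult mult' int_pow_mult)
qed (use assms in auto)

section \<open>The extended special linear group\<close>

lemma group_ESL: "group (ESL n :: 'a::comm_ring_1 mat monoid)"
proof (rule groupI)
  show "\<exists>B\<in>carrier (ESL n). B \<otimes>\<^bsub>ESL n\<^esub> A = \<one>\<^bsub>ESL n\<^esub>"
    if "A \<in> carrier (ESL n)" for A :: "'a mat"
  proof
    have A: "A \<in> carrier_mat n n" and d: "det A * det A = 1" "det A = 1 \<or> det A = - 1"
      using that by (auto simp: ESL_def)
    (* The inverse is det A times the adjugate, as det A is its own inverse. *)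
    let ?B = "det A \<cdot>\<^sub>m adj_mat A"
    note adj = adj_mat[OF A]
    have B: "?B \<in> carrier_mat n n" using adj(1) by simp
    have "?B * A = det A \<cdot>\<^sub>m (det A \<cdot>\<^sub>m 1\<^sub>m n)"
      using A adj by (simp add: mult_smult_assoc_mat)
    then have BA: "?B * A = 1\<^sub>m n"
      using d(1) by (auto intro!: eq_matI simp flip: mult.assoc)
    then have "det ?B * det A = 1"
      using det_mult[OF B A] by simp
    then have "det ?B = 1 \<or> det ?B = - 1"
      using d(2) by (metis mult.right_neutral mult_minus_right minus_minus)
    then show "?B \<in> carrier (ESL n)" using B by (simp add: ESL_def)
    show "?B \<otimes>\<^bsub>ESL n\<^esub> A = \<one>\<^bsub>ESL n\<^esub>" using BA by (simp add: ESL_def)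
  qed
qed (auto simp: ESL_def det_mult)

lemma finite_carrier_mat: "finite (carrier_mat m n :: 'a::finite mat set)"
proof -
  have "carrier_mat m n \<subseteq>
    (\<lambda>f :: nat \<times> nat \<Rightarrow> 'a. mat m n f) ` (({0..<m} \<times> {0..<n}) \<rightarrow>\<^sub>E UNIV)"
  proof
    fix A :: "'a mat" assume "A \<in> carrier_mat m n"
    then have "A = mat m n (restrict (\<lambda>ij. A $$ ij) ({0..<m} \<times> {0..<n}))"
      by (auto intro!: eq_matI)
    then show "A \<in> (\<lambda>f. mat m n f) ` (({0..<m} \<times> {0..<n}) \<rightarrow>\<^sub>E UNIV)"
      by (metis (no_types, lifting) image_eqI restrict_PiE_iff UNIV_I)
  qed
  then show ?thesis
    by (rule finite_subset) (intro finite_imageI finite_PiE; simp)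
qed

definition unipotent3 :: "'a::idom mat" where
  "unipotent3 = mat_of_rows_list 3 [[1, 1, 0], [0, 1, 1], [0, 0, 1]]"

lemma unipotent3_carrier: "unipotent3 \<in> carrier_mat 3 3"
  by (auto simp: unipotent3_def mat_of_rows_list_def)

lemma det_unipotent3: "det (unipotent3 :: 'a::idom mat) = 1"
proof -
  have "det (unipotent3 :: 'a mat) = prod_list (diag_mat unipotent3)"
    by (rule det_upper_triangular[OF _ unipotent3_carrier])
      (auto simp: unipotent3_def mat_of_rows_list_def upper_triangular_def less_Suc_eq numeral_3_eq_3)
  also have "\<dots> = 1"
    by (simp add: diag_mat_def unipotent3_def mat_of_rows_list_def upt_rec)
  finally show ?thesis .
qed

text \<open>
  In the upper left entry the products are 6 and 1, in the entry to its right they are 4 and 2.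
  The differences 5 and 2 are coprime as integers, so they are not both 0 in a nontrivial ring.
\<close>

lemma unipotent3_squares_not_commute:
  fixes X :: "'a::idom mat"
  defines "X \<equiv> unipotent3"
  defines "Y \<equiv> transpose_mat unipotent3"
  shows "(X * X) * (Y * Y) \<noteq> (Y * Y) * (X * X)"
proof
  assume eq: "(X * X) * (Y * Y) = (Y * Y) * (X * X)"
  have XX: "X * X = mat_of_rows_list 3 [[1, 2, 1], [0, 1, 2], [0, 0, 1]]"
    by (rule eq_matI)
      (auto simp: X_def unipotent3_def mat_of_rows_list_def scalar_prod_def
        numeral_3_eq_3 less_Suc_eq)
  have YY: "Y * Y = mat_of_rows_list 3 [[1, 0, 0], [2, 1, 0], [1, 2, 1]]"
    by (rule eq_matI)
      (auto simp: Y_def unipotent3_def mat_of_rows_list_def scalar_prod_def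
        numeral_3_eq_3 less_Suc_eq)
  have "((X * X) * (Y * Y)) $$ (0, 0) = 6" "((X * X) * (Y * Y)) $$ (0, 1) = 4"
    "((Y * Y) * (X * X)) $$ (0, 0) = 1" "((Y * Y) * (X * X)) $$ (0, 1) = 2"
    unfolding XX YY
    by (simp_all add: mat_of_rows_list_def scalar_prod_def numeral_3_eq_3)
  then have "(6::'a) = 1" "(4::'a) = 2" using eq by auto
  (* 5 - 2 * 2 = 1, written with the two differences *)
  then have "(6 - 1) - 2 * (4 - 2) = (0::'a)" by simp
  then show False by simp
qed

definition block_sum_one :: "nat \<Rightarrow> 'a::idom mat \<Rightarrow> 'a mat" where
  "block_sum_one m A = four_block_mat A (0\<^sub>m (dim_row A) m) (0\<^sub>m m (dim_col A)) (1\<^sub>m m)"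

text \<open>
  Together with \<open>block_sum_one_eq_iff\<close> and \<open>block_sum_one_in_ESL\<close>, this says that the block sum
  embeds matrices of determinant 1 into a larger \<open>ESL\<close>, so a failure of commutation in size 3
  persists in all larger sizes.
\<close>

lemma block_sum_one_mult:
  assumes "A \<in> carrier_mat k k" "B \<in> carrier_mat k k"
  shows "block_sum_one m A * block_sum_one m B = block_sum_one m (A * B)"
  using assms unfolding block_sum_one_def
  by (subst mult_four_block_mat[of _ k k _ m _ m _ _ k _ m]) auto

lemma block_sum_one_eq_iff:
  assumes "A \<in> carrier_mat k k" "B \<in> carrier_mat k k"
  shows "block_sum_one m A = block_sum_one m B \<longleftrightarrow> A = B"
proof
  assume eq: "block_sum_one m A = block_sum_one m B"
  show "A = B"
  proof (rule eq_matI)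
    fix i j assume "i < dim_row B" "j < dim_col B"
    then show "A $$ (i, j) = B $$ (i, j)"
      using arg_cong[OF eq, of "\<lambda>M. M $$ (i, j)"] assms
      by (simp add: block_sum_one_def)
  qed (use assms in auto)
qed simp

lemma block_sum_one_in_ESL:
  assumes "A \<in> carrier_mat k k" "det A = 1"
  shows "block_sum_one m A \<in> carrier (ESL (k + m))"
proof -
  have "det (block_sum_one m A) = 1"
    using det_four_block_mat_upper_right_zero[OF assms(1) refl, of "0\<^sub>m m k" m "1\<^sub>m m"] assms
    by (simp add: block_sum_one_def)
  then show ?thesis
    using assms(1) by (simp add: ESL_def block_sum_one_def)
qed

lemma ESL_squares_not_commute:
  assumes "n > 2"
  obtains A B where "A \<in> carrier (ESL n :: 'a::idom mat monoid)" "B \<in> carrier (ESL n)"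
    "(A * A) * (B * B) \<noteq> (B * B) * (A * A)"
proof -
  define m where "m = n - 3"
  have n: "n = 3 + m" using assms by (simp add: m_def)
  let ?X = "unipotent3 :: 'a mat"
  let ?Y = "transpose_mat ?X"
  have X: "?X \<in> carrier_mat 3 3" and Y: "?Y \<in> carrier_mat 3 3"
    using unipotent3_carrier by auto
  have dets: "det ?X = 1" "det ?Y = 1"
    using det_unipotent3 det_transpose[OF X] by simp_all
  show ?thesis
  proof
    show "block_sum_one m ?X \<in> carrier (ESL n)" "block_sum_one m ?Y \<in> carrier (ESL n)"
      unfolding n using X Y dets by (simp_all add: block_sum_one_in_ESL)
    let ?XXYY = "(?X * ?X) * (?Y * ?Y)" and ?YYXX = "(?Y * ?Y) * (?X * ?X)"
    have "?XXYY \<in> carrier_mat 3 3" "?YYXX \<in> carrier_mat 3 3"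
      using mult_carrier_mat[OF mult_carrier_mat[OF X X] mult_carrier_mat[OF Y Y]]
        mult_carrier_mat[OF mult_carrier_mat[OF Y Y] mult_carrier_mat[OF X X]] .
    then have "block_sum_one m ?XXYY \<noteq> block_sum_one m ?YYXX"
      using block_sum_one_eq_iff unipotent3_squares_not_commute by blast
    moreover have "block_sum_one m ?X * block_sum_one m ?X * (block_sum_one m ?Y * block_sum_one m ?Y)
        = block_sum_one m ?XXYY"
      "block_sum_one m ?Y * block_sum_one m ?Y * (block_sum_one m ?X * block_sum_one m ?X)
        = block_sum_one m ?YYXX"
      using X Y by (simp_all add: block_sum_one_mult[where k = 3])
    ultimately show "block_sum_one m ?X * block_sum_one m ?X * (block_sum_one m ?Y * block_sum_one m ?Y)
        \<noteq> block_sum_one m ?Y * block_sum_one m ?Y * (block_sum_one m ?X * block_sum_one m ?X)"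
      by (simp only: not_False_eq_True)
  qed
qed

lemma ESL_involutive_generating_set_card_ge_3:
  fixes S :: "'a::{finite, idom} mat set"
  assumes "n > 2" and S: "involutive_generating_set (ESL n) S"
  shows "finite S \<and> card S \<ge> 3"
proof
  interpret group "ESL n :: 'a mat monoid" by (rule group_ESL)
  have "S \<subseteq> carrier_mat n n"
    using S by (auto simp: involutive_generating_set_def generating_set_def ESL_def)
  then show fin: "finite S"
    by (rule finite_subset) (rule finite_carrier_mat)
  obtain A B :: "'a mat" where AB: "A \<in> carrier (ESL n)" "B \<in> carrier (ESL n)"
    "(A * A) * (B * B) \<noteq> (B * B) * (A * A)"
    using ESL_squares_not_commute[OF assms(1)] .
  show "card S \<ge> 3"
  proof (rule ccontr)
    assume "\<not> card S \<ge> 3"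
    then have "card S \<le> 2" by simp
    from involutive_generating_set_card_le_2_squares_commute[OF S fin this AB(1,2)] AB(3)
    show False by (simp add: ESL_def)
  qed
qed

section \<open>The case of two by two matrices over the field with two elements\<close>

abbreviation mat2 :: "'a \<Rightarrow> 'a \<Rightarrow> 'a \<Rightarrow> 'a \<Rightarrow> 'a mat" where
  "mat2 a b c d \<equiv> mat_of_rows_list 2 [[a, b], [c, d]]"

lemma mat2_mult:
  "mat2 a b c d * mat2 a' b' c' d' =
   mat2 (a * a' + b * c') (a * b' + b * d') (c * a' + d * c') (c * b' + d * (d'::'a::comm_ring_1))"
  by (rule eq_matI)
    (auto simp: mat_of_rows_list_def scalar_prod_def numeral_2_eq_2 less_Suc_eq)

lemma mat2_eq_iff:
  "mat2 a b c d = mat2 a' b' c' d' \<longleftrightarrow> a = a' \<and> b = b' \<and> c = c' \<and> d = d'"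
proof
  assume eq: "mat2 a b c d = mat2 a' b' c' d'"
  show "a = a' \<and> b = b' \<and> c = c' \<and> d = d'"
    using arg_cong[OF eq, of "\<lambda>M. M $$ (0, 0)"] arg_cong[OF eq, of "\<lambda>M. M $$ (0, 1)"]
      arg_cong[OF eq, of "\<lambda>M. M $$ (1, 0)"] arg_cong[OF eq, of "\<lambda>M. M $$ (1, 1)"]
    by (simp add: mat_of_rows_list_def)
qed simp

lemma one_mat2: "1\<^sub>m 2 = mat2 1 0 0 (1::'a::comm_ring_1)"
  by (rule eq_matI) (auto simp: mat_of_rows_list_def numeral_2_eq_2 less_Suc_eq)

lemma mat2_exhaust:
  assumes "A \<in> carrier_mat 2 2"
  obtains a b c d where "A = mat2 a b c d"
proof
  show "A = mat2 (A $$ (0, 0)) (A $$ (0, 1)) (A $$ (1, 0)) (A $$ (1, 1))"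
    by (rule eq_matI)
      (use assms in \<open>auto simp: mat_of_rows_list_def numeral_2_eq_2 less_Suc_eq\<close>)
qed

lemma det_mat2: "det (mat2 a b c d) = a * d - b * (c::'a::comm_ring_1)"
proof -
  have "mat2 a b c d \<in> carrier_mat 2 2"
    by (auto simp: mat_of_rows_list_def)
  from laplace_expansion_row[OF this, of 0] show ?thesis
    by (simp add: numeral_2_eq_2 cofactor_def mat_delete_def mat_of_rows_list_def det_single)
qed

lemma mat2_in_ESL:
  "mat2 a b c d \<in> carrier (ESL 2) \<longleftrightarrow> a * d - b * c = 1 \<or> a * d - b * c = - (1::'a::comm_ring_1)"
  by (auto simp: ESL_def det_mat2) (auto simp: mat_of_rows_list_def)

text \<open>
  The field with two elements is described here as a commutative ring \<open>'a\<close> in which every element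
  is 0 or 1; this is the form in which case distinctions on matrix entries use it.
\<close>

lemma two_eq_zero:
  assumes F2: "\<And>x::'a::comm_ring_1. x = 0 \<or> x = 1"
  shows "(2::'a) = 0"
proof -
  have "(1::'a) + 1 \<noteq> 1 + 0"
    by (simp only: add_left_cancel one_neq_zero not_False_eq_True)
  then show ?thesis
    using F2[of "1 + 1"] by simp
qed

text \<open>
  The rotation by a third of a turn goes to \<open>\<rho> t\<^sub>1\<^sub>2\<close>, the reflection to \<open>\<rho>\<close>.  Bijectivity is read off
  from the list of the six values.
\<close>

lemma iso_dihedral_3_ESL_2:
  assumes F2: "\<And>x::'a::comm_ring_1. x = 0 \<or> x = 1"
  shows "(\<lambda>(k, a). (rho_mat * t12_mat) [^]\<^bsub>ESL 2\<^esub> k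
      \<otimes>\<^bsub>ESL 2\<^esub> (if a then rho_mat else \<one>\<^bsub>ESL 2\<^esub>))
    \<in> iso (dihedral_group 3) (ESL 2 :: 'a mat monoid)"
    (is "?\<phi> \<in> _")
proof -
  interpret group "ESL 2 :: 'a mat monoid" by (rule group_ESL)
  have two: "(2::'a) = 0"
    by (rule two_eq_zero) (rule F2)
  then have minus: "- (1::'a) = 1"
    by (simp add: minus_unique)
  note [simp] = two minus
  let ?r = "rho_mat * t12_mat :: 'a mat"
  have mult: "A \<otimes>\<^bsub>ESL 2\<^esub> B = A * B" and one: "\<one>\<^bsub>ESL 2\<^esub> = mat2 1 0 0 1" for A B :: "'a mat"
    by (simp_all add: ESL_def one_mat2)
  have r: "?r = mat2 0 1 1 1"
    by (simp add: rho_mat_def t12_mat_def mat2_mult)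
  have carriers: "rho_mat \<in> carrier (ESL 2 :: 'a mat monoid)"
      "t12_mat \<in> carrier (ESL 2 :: 'a mat monoid)"
      "?r \<in> carrier (ESL 2)"
    by (simp_all add: r) (simp_all add: rho_mat_def t12_mat_def mat2_in_ESL)
  have squares: "rho_mat \<otimes>\<^bsub>ESL 2\<^esub> rho_mat = \<one>\<^bsub>ESL 2 :: 'a mat monoid\<^esub>"
      "t12_mat \<otimes>\<^bsub>ESL 2\<^esub> t12_mat = \<one>\<^bsub>ESL 2 :: 'a mat monoid\<^esub>"
    by (simp_all add: mult one rho_mat_def t12_mat_def mat2_mult)
  have pow2: "?r [^]\<^bsub>ESL 2\<^esub> (2::nat) = mat2 1 1 1 0"
    using nat_pow_Suc[of ?r 1] carriers(3)
    by (simp add: Suc_1 mult r mat2_mult del: nat_pow_Suc One_nat_def)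
  have pow3: "?r [^]\<^bsub>ESL 2\<^esub> (3::nat) = \<one>\<^bsub>ESL 2\<^esub>"
    using nat_pow_Suc[of ?r 2] by (simp add: pow2[unfolded r] mult one r mat2_mult)
  have hom: "?\<phi> \<in> hom (dihedral_group 3) (ESL 2)"
    using hom_dihedral_group[OF carriers(3,1) pow3 squares(1)]
      involution_inverts_product(2)[OF carriers(1,2) squares] by (simp add: mult)
  have dihedral: "carrier (dihedral_group 3) =
      {(0, False), (1, False), (2, False), (0, True), (1, True), (2, True)}"
    by (auto simp: dihedral_group_def)
  have images: "?\<phi> (0, False) = mat2 1 0 0 1" "?\<phi> (1, False) = mat2 0 1 1 1"
    "?\<phi> (2, False) = mat2 1 1 1 0" "?\<phi> (0, True) = mat2 0 1 1 0"
    "?\<phi> (1, True) = mat2 1 0 1 1" "?\<phi> (2, True) = mat2 1 1 0 1"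
    using carriers int_pow_int[of "ESL 2" ?r 2]
    by (simp_all add: pow2[unfolded r] mult one r) (simp_all add: mult one rho_mat_def mat2_mult)
  have "inj_on ?\<phi> (carrier (dihedral_group 3))"
    unfolding dihedral inj_on_def ball_simps images by (simp add: mat2_eq_iff)
  moreover have "carrier (ESL 2) \<subseteq> ?\<phi> ` carrier (dihedral_group 3)"
  proof
    fix A :: "'a mat" assume A: "A \<in> carrier (ESL 2)"
    then have "A \<in> carrier_mat 2 2" by (simp add: ESL_def)
    then obtain a b c d where abcd: "A = mat2 a b c d" by (rule mat2_exhaust)
    have "a * d - b * c = 1"
      using A by (simp add: abcd mat2_in_ESL)
    with F2[of a] F2[of b] F2[of c] F2[of d]
    have "A \<in> {mat2 1 0 0 1, mat2 0 1 1 1, mat2 1 1 1 0, mat2 0 1 1 0, mat2 1 0 1 1, mat2 1 1 0 1}"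
      unfolding abcd insert_iff mat2_eq_iff by (elim disjE) simp_all
    then show "A \<in> ?\<phi> ` carrier (dihedral_group 3)"
      unfolding dihedral image_insert image_empty images .
  qed
  ultimately show ?thesis
    using hom hom_carrier[OF hom] by (auto simp: iso_def bij_betw_def)
qed

text \<open>
  By the isomorphism with the dihedral group every matrix is a power of \<open>\<rho> t\<^sub>1\<^sub>2\<close>, possibly times
  \<open>\<rho>\<close>.
\<close>

lemma ESL_2_generated_by_two_involutions:
  assumes F2: "\<And>x::'a::comm_ring_1. x = 0 \<or> x = 1"
  shows "involutive_generating_set (ESL 2 :: 'a mat monoid) {rho_mat, t12_mat}"
proof -
  interpret group "ESL 2 :: 'a mat monoid" by (rule group_ESL)
  have "(2::'a) = 0"
    by (rule two_eq_zero) (rule F2)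
  then have invol: "involution (ESL 2 :: 'a mat monoid) rho_mat"
      "involution (ESL 2 :: 'a mat monoid) t12_mat"
    unfolding involution_iff rho_mat_def t12_mat_def mat2_in_ESL
    by (simp_all add: ESL_def mat2_mult mat2_eq_iff one_mat2)
  let ?H = "generate (ESL 2 :: 'a mat monoid) {rho_mat, t12_mat}"
  have carriers: "{rho_mat, t12_mat} \<subseteq> carrier (ESL 2 :: 'a mat monoid)"
    using invol by (simp add: involution_def)
  have sub: "subgroup ?H (ESL 2)"
    using carriers by (rule generate_is_subgroup)
  have rho: "rho_mat \<in> ?H" and t12: "t12_mat \<in> ?H"
    by (auto intro: generate.incl)
  have r: "rho_mat * t12_mat \<in> ?H"
    using generate.eng[OF rho t12] by (simp add: ESL_def)
  have "x \<in> ?H" if x: "x \<in> carrier (ESL 2)" for x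
  proof -
    let ?\<phi> = "\<lambda>(k::int, a). (rho_mat * t12_mat) [^]\<^bsub>ESL 2\<^esub> k
      \<otimes>\<^bsub>ESL 2\<^esub> (if a then rho_mat else \<one>\<^bsub>ESL 2\<^esub>)"
    have "?\<phi> ` carrier (dihedral_group 3) = carrier (ESL 2 :: 'a mat monoid)"
      using iso_dihedral_3_ESL_2[OF F2] unfolding iso_def bij_betw_def by blast
    then obtain y where "x = ?\<phi> y"
      using x by blast
    moreover obtain k a where "y = (k, a)" by force
    ultimately have "x = (rho_mat * t12_mat) [^]\<^bsub>ESL 2\<^esub> k
        \<otimes>\<^bsub>ESL 2\<^esub> (if a then rho_mat else \<one>\<^bsub>ESL 2\<^esub>)"
      by (simp only: prod.case)
    then show ?thesis
      using subgroup_int_pow_closed[OF sub r, of k] rho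
      by (auto intro: generate.eng generate.one)
  qed
  then have "?H = carrier (ESL 2)"
    using generate_in_carrier[OF carriers] by blast
  then show ?thesis
    using carriers invol by (simp add: involutive_generating_set_def generating_set_def)
qed

lemma ESL_2_not_commutative:
  "rho_mat * t12_mat \<noteq> t12_mat * (rho_mat :: 'a::comm_ring_1 mat)"
  by (simp add: rho_mat_def t12_mat_def mat2_mult mat2_eq_iff)

lemma ESL_2_minimal_involutive_generating_set:
  assumes F2: "\<And>x::'a::comm_ring_1. x = 0 \<or> x = 1"
  shows "minimal_involutive_generating_set (ESL 2 :: 'a mat monoid) {rho_mat, t12_mat}"
    and "card {rho_mat :: 'a mat, t12_mat} = 2"
proof -
  interpret group "ESL 2 :: 'a mat monoid" by (rule group_ESL)
  show card: "card {rho_mat :: 'a mat, t12_mat} = 2"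
    using ESL_2_not_commutative[where 'a = 'a] by (cases "rho_mat = (t12_mat :: 'a mat)") auto
  have gen: "involutive_generating_set (ESL 2 :: 'a mat monoid) {rho_mat, t12_mat}"
    by (rule ESL_2_generated_by_two_involutions) (rule F2)
  have False if T: "involutive_generating_set (ESL 2 :: 'a mat monoid) T"
    and less: "T \<prec> {rho_mat :: 'a mat, t12_mat}" for T
  proof -
    have "T \<lesssim> {rho_mat :: 'a mat, t12_mat}"
      and not_eqpoll: "\<not> T \<approx> {rho_mat :: 'a mat, t12_mat}"
      using less by (simp_all add: lesspoll_def)
    then obtain f where f: "inj_on f T" "f ` T \<subseteq> {rho_mat :: 'a mat, t12_mat}"
      unfolding lepoll_def by blast
    then have fin: "finite T"
      by (meson finite.emptyI finite.insertI inj_on_finite)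
    have "card T \<le> 2"
      using card_inj_on_le[OF f] card by simp
    moreover have "card T \<noteq> 2"
    proof
      assume "card T = 2"
      then have "card T = card {rho_mat :: 'a mat, t12_mat}"
        by (simp only: card)
      then show False
        using not_eqpoll eqpoll_iff_card[OF fin, of "{rho_mat :: 'a mat, t12_mat}"]
        by (simp only: finite.emptyI finite.insertI not_True_eq_False)
    qed
    ultimately have "card T \<le> 1" by simp
    moreover have "rho_mat \<in> carrier (ESL 2 :: 'a mat monoid)"
      "t12_mat \<in> carrier (ESL 2 :: 'a mat monoid)"
      using gen by (auto simp: involutive_generating_set_def generating_set_def)
    ultimately have "rho_mat * t12_mat = t12_mat * (rho_mat :: 'a mat)"
      using involutive_generating_set_card_le_1_comm[OF T fin, of rho_mat t12_mat]
      by (simp add: ESL_def)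
    then show False using ESL_2_not_commutative by blast
  qed
  then show "minimal_involutive_generating_set (ESL 2 :: 'a mat monoid) {rho_mat, t12_mat}"
    using gen by (auto simp: minimal_involutive_generating_set_def)
qed

lemma mod_ring_2_cases:
  fixes x :: "'p::prime_card mod_ring"
  assumes "CARD('p) = 2"
  shows "x = 0 \<or> x = 1"
proof -
  obtain i :: nat where "i < 2" "x = of_nat i"
    using surj_of_nat_mod_ring[of x] assms by auto
  then show ?thesis by (auto simp: less_2_cases_iff)
qed

theorem theorem3p3:
  fixes p :: nat
  assumes "prime p" and "CARD('p::prime_card) = p"
  shows
    "(\<forall>n>2. \<forall>S. minimal_involutive_generating_set (ESL n :: 'p mod_ring mat monoid) S
        \<longrightarrow> finite S \<and> card S \<ge> 3) \<and>
     (p = 2 \<longrightarrow>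
        (\<exists>S. minimal_involutive_generating_set (ESL 2 :: 'p mod_ring mat monoid) S \<and> card S = 2) \<and>
        (ESL 2 :: 'p mod_ring mat monoid) \<cong> dihedral_group 3 \<and>
        dihedral_group 3 \<cong> subgroup_generated (ESL 2 :: 'p mod_ring mat monoid) {rho_mat, t12_mat})"
proof (intro conjI allI impI)
  fix n :: nat and S :: "'p mod_ring mat set"
  assume "n > 2" and "minimal_involutive_generating_set (ESL n) S"
  then have "finite S \<and> card S \<ge> 3"
    using ESL_involutive_generating_set_card_ge_3
    by (auto simp: minimal_involutive_generating_set_def)
  then show "finite S" and "card S \<ge> 3" by auto
next
  assume "p = 2"
  then have F2: "x = 0 \<or> x = 1" for x :: "'p mod_ring"
    using assms(2) mod_ring_2_cases by blast
  show "\<exists>S. minimal_involutive_generating_set (ESL 2 :: 'p mod_ring mat monoid) S \<and> card S = 2"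
    using ESL_2_minimal_involutive_generating_set[OF F2] by blast
  have iso: "dihedral_group 3 \<cong> (ESL 2 :: 'p mod_ring mat monoid)"
    using iso_dihedral_3_ESL_2[OF F2] by (auto simp: is_iso_def)
  show "(ESL 2 :: 'p mod_ring mat monoid) \<cong> dihedral_group 3"
    using iso by (rule group.iso_sym[OF group_dihedral_group, rotated]) simp
  have "subgroup_generated (ESL 2 :: 'p mod_ring mat monoid) {rho_mat, t12_mat} = ESL 2"
    using ESL_2_generated_by_two_involutions[OF F2]
    by (auto simp: involutive_generating_set_def generating_set_def subgroup_generated_def
        Int_absorb1)
  then show "dihedral_group 3 \<cong> subgroup_generated (ESL 2 :: 'p mod_ring mat monoid) {rho_mat, t12_mat}"
    using iso by simp
qed

end
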